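(* Let $N=(G=(V,E),\sigma,u,s)$ be a skew-symmetric network in which no arc enters $s$. Then every maximum IS-flow in $N$ is an optimal solution of the linear program: maximize $\sum_{a\text{ leaving }s}f(a)$ over $f\in\mathbb R^E$ subject to $0\le f(a)\le u(a)$ for all $a\in E$; $\sum_{a\text{ leaving }v}f(a)-\sum_{a\text{ entering }v}f(a)=0$ for all $v\in V\setminus\{s,s'\}$; and $\sum_{a\in E}f(a)\chi_\rho(a)\le 2u(U_\rho)-2$ for every odd fragment $\rho=(V_\rho,U_\rho)$. (In particular, this LP has no symmetry or integrality constraints, and its optimum value equals the maximum IS-flow value.)
   Context: A skew-symmetric graph is a finite directed graph $G=(V,E)$ (parallel arcs allowed) with a map $\sigma$ of $V\cup E$ onto itself such that $\sigma(x)\ne x$, $\sigma(\sigma(x))=x$ for all $x$, $\sigma(V)=V$, and for each arc $a$ from $v$ to $w$, $\sigma(a)$ is an arc from $\sigma(w)$ to $\sigma(v)$. A function on $E$ is symmetric if it takes equal values on $a$ and $\sigma(a)$. A skew-symmetric network is $N=(G,\sigma,u,s)$ with $u:E\to\mathbb Z_{\ge0}$ symmetric and source $s$; $s'=\sigma(s)$. A flow is $f:E\to\mathbb R_{\ge0}$ with $f\le u$ and conservation at nodes other than $s,s'$; an IS-flow is an integer-valued symmetric flow, and a maximum IS-flow is one of maximum value (net outflow at $s$). For $S\subseteq E$, $u(S)=\sum_{a\in S}u(a)$. An odd fragment is a pair $\rho=(V_\rho,U_\rho)$ where $V_\rho\subseteq V$ is self-symmetric ($\sigma(V_\rho)=V_\rho$),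 $s\notin V_\rho$, and $U_\rho$ is a set of arcs entering $V_\rho$ with $u(U_\rho)$ odd. Its characteristic function $\chi_\rho:E\to\{-1,0,1\}$ is $\chi_\rho(a)=1$ if $a\in U_\rho\cup\sigma(U_\rho)$, $\chi_\rho(a)=-1$ if $a\in\delta(V_\rho)\setminus(U_\rho\cup\sigma(U_\rho))$, and $0$ otherwise, where $\delta(V_\rho)$ is the set of arcs with exactly one end in $V_\rho$. *)

theory Defs
  imports Complex_Main
begin

text \<open>A skew-symmetric network: finite vertex set V, finite arc set E (parallel arcs
allowed, arcs are abstract objects with tail tail and head head), the skew-symmetry sigma
given by its restrictions sv (on vertices) and se (on arcs), symmetric capacities u
and source s.\<close>

definition skew_sym_network ::
  "'v set \<Rightarrow> 'e set \<Rightarrow> ('e \<Rightarrow> 'v) \<Rightarrow> ('e \<Rightarrow> 'v) \<Rightarrow> ('v \<Rightarrow> 'v) \<Rightarrow> ('e \<Rightarrow> 'e)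
   \<Rightarrow> ('e \<Rightarrow> nat) \<Rightarrow> 'v \<Rightarrow> bool" where
  "skew_sym_network V E tail head sv se u s \<longleftrightarrow>
     finite V \<and> finite E \<and>
     (\<forall>a\<in>E. tail a \<in> V \<and> head a \<in> V) \<and>
     (\<forall>v\<in>V. sv v \<in> V \<and> sv v \<noteq> v \<and> sv (sv v) = v) \<and>
     (\<forall>a\<in>E. se a \<in> E \<and> se a \<noteq> a \<and> se (se a) = a) \<and>
     (\<forall>a\<in>E. tail (se a) = sv (head a) \<and> head (se a) = sv (tail a)) \<and>
     (\<forall>a\<in>E. u (se a) = u a) \<and>
     s \<in> V"

definition arcs_out :: "'e set \<Rightarrow> ('e \<Rightarrow> 'v) \<Rightarrow> 'v \<Rightarrow> 'e set" where
  "arcs_out E tail v = {a\<in>E. tail a = v}"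

definition arcs_in :: "'e set \<Rightarrow> ('e \<Rightarrow> 'v) \<Rightarrow> 'v \<Rightarrow> 'e set" where
  "arcs_in E head v = {a\<in>E. head a = v}"

definition is_flow ::
  "'v set \<Rightarrow> 'e set \<Rightarrow> ('e \<Rightarrow> 'v) \<Rightarrow> ('e \<Rightarrow> 'v) \<Rightarrow> ('v \<Rightarrow> 'v)
   \<Rightarrow> ('e \<Rightarrow> nat) \<Rightarrow> 'v \<Rightarrow> ('e \<Rightarrow> real) \<Rightarrow> bool" where
  "is_flow V E tail head sv u s f \<longleftrightarrow>
     (\<forall>a\<in>E. 0 \<le> f a \<and> f a \<le> real (u a)) \<and>
     (\<forall>v\<in>V - {s, sv s}. (\<Sum>a\<in>arcs_out E tail v. f a) - (\<Sum>a\<in>arcs_in E head v. f a) = 0)"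

definition flow_value :: "'e set \<Rightarrow> ('e \<Rightarrow> 'v) \<Rightarrow> ('e \<Rightarrow> 'v) \<Rightarrow> 'v \<Rightarrow> ('e \<Rightarrow> real) \<Rightarrow> real" where
  "flow_value E tail head s f = (\<Sum>a\<in>arcs_out E tail s. f a) - (\<Sum>a\<in>arcs_in E head s. f a)"

definition is_IS_flow ::
  "'v set \<Rightarrow> 'e set \<Rightarrow> ('e \<Rightarrow> 'v) \<Rightarrow> ('e \<Rightarrow> 'v) \<Rightarrow> ('v \<Rightarrow> 'v) \<Rightarrow> ('e \<Rightarrow> 'e)
   \<Rightarrow> ('e \<Rightarrow> nat) \<Rightarrow> 'v \<Rightarrow> ('e \<Rightarrow> real) \<Rightarrow> bool" where
  "is_IS_flow V E tail head sv se u s f \<longleftrightarrow>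
     is_flow V E tail head sv u s f \<and> (\<forall>a\<in>E. f a \<in> \<int> \<and> f (se a) = f a)"

definition is_max_IS_flow ::
  "'v set \<Rightarrow> 'e set \<Rightarrow> ('e \<Rightarrow> 'v) \<Rightarrow> ('e \<Rightarrow> 'v) \<Rightarrow> ('v \<Rightarrow> 'v) \<Rightarrow> ('e \<Rightarrow> 'e)
   \<Rightarrow> ('e \<Rightarrow> nat) \<Rightarrow> 'v \<Rightarrow> ('e \<Rightarrow> real) \<Rightarrow> bool" where
  "is_max_IS_flow V E tail head sv se u s f \<longleftrightarrow>
     is_IS_flow V E tail head sv se u s f \<and>
     (\<forall>g. is_IS_flow V E tail head sv se u s g \<longrightarrow> flow_value E tail head s g \<le> flow_value E tail head s f)"

definition odd_fragment ::
  "'v set \<Rightarrow> 'e set \<Rightarrow> ('e \<Rightarrow> 'v) \<Rightarrow> ('e \<Rightarrow> 'v) \<Rightarrow> ('v \<Rightarrow> 'v)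
   \<Rightarrow> ('e \<Rightarrow> nat) \<Rightarrow> 'v \<Rightarrow> 'v set \<Rightarrow> 'e set \<Rightarrow> bool" where
  "odd_fragment V E tail head sv u s Vr Ur \<longleftrightarrow>
     Vr \<subseteq> V \<and> sv ` Vr = Vr \<and> s \<notin> Vr \<and>
     Ur \<subseteq> {a\<in>E. tail a \<notin> Vr \<and> head a \<in> Vr} \<and>
     odd (\<Sum>a\<in>Ur. u a)"

definition cut_arcs :: "'e set \<Rightarrow> ('e \<Rightarrow> 'v) \<Rightarrow> ('e \<Rightarrow> 'v) \<Rightarrow> 'v set \<Rightarrow> 'e set" where
  "cut_arcs E tail head Vr = {a\<in>E. (tail a \<in> Vr) \<noteq> (head a \<in> Vr)}"

definition frag_char ::
  "'e set \<Rightarrow> ('e \<Rightarrow> 'v) \<Rightarrow> ('e \<Rightarrow> 'v) \<Rightarrow> ('e \<Rightarrow> 'e) \<Rightarrow> 'v set \<Rightarrow> 'e set \<Rightarrow> 'e \<Rightarrow> real" where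
  "frag_char E tail head se Vr Ur a =
     (if a \<in> Ur \<union> se ` Ur then 1
      else if a \<in> cut_arcs E tail head Vr then -1 else 0)"

definition lp_feasible ::
  "'v set \<Rightarrow> 'e set \<Rightarrow> ('e \<Rightarrow> 'v) \<Rightarrow> ('e \<Rightarrow> 'v) \<Rightarrow> ('v \<Rightarrow> 'v) \<Rightarrow> ('e \<Rightarrow> 'e)
   \<Rightarrow> ('e \<Rightarrow> nat) \<Rightarrow> 'v \<Rightarrow> ('e \<Rightarrow> real) \<Rightarrow> bool" where
  "lp_feasible V E tail head sv se u s f \<longleftrightarrow>
     (\<forall>a\<in>E. 0 \<le> f a \<and> f a \<le> real (u a)) \<and>
     (\<forall>v\<in>V - {s, sv s}. (\<Sum>a\<in>arcs_out E tail v. f a) - (\<Sum>a\<in>arcs_in E head v. f a) = 0) \<and>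
     (\<forall>Vr Ur. odd_fragment V E tail head sv u s Vr Ur \<longrightarrow>
        (\<Sum>a\<in>E. f a * frag_char E tail head se Vr Ur a) \<le> 2 * real (\<Sum>a\<in>Ur. u a) - 2)"

definition lp_objective :: "'e set \<Rightarrow> ('e \<Rightarrow> 'v) \<Rightarrow> 'v \<Rightarrow> ('e \<Rightarrow> real) \<Rightarrow> real" where
  "lp_objective E tail s f = (\<Sum>a\<in>arcs_out E tail s. f a)"

definition lp_optimal ::
  "'v set \<Rightarrow> 'e set \<Rightarrow> ('e \<Rightarrow> 'v) \<Rightarrow> ('e \<Rightarrow> 'v) \<Rightarrow> ('v \<Rightarrow> 'v) \<Rightarrow> ('e \<Rightarrow> 'e)
   \<Rightarrow> ('e \<Rightarrow> nat) \<Rightarrow> 'v \<Rightarrow> ('e \<Rightarrow> real) \<Rightarrow> bool" where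
  "lp_optimal V E tail head sv se u s f \<longleftrightarrow>
     lp_feasible V E tail head sv se u s f \<and>
     (\<forall>g. lp_feasible V E tail head sv se u s g \<longrightarrow> lp_objective E tail s g \<le> lp_objective E tail s f)"

end

theory Submission
  imports Defs
begin

text \<open>A trail in the residual graph of unit arcs is \<^emph>\<open>regular\<close> if it repeats no unit arc and
  contains no two mates. A regular trail from \<open>s\<close> to \<open>s'\<close> together with its mirror image
  augments an IS-flow by 2, so for a maximum IS-flow \<open>s'\<close> is not reachable by regular trails.
  The nodes \<open>v\<close> such that both \<open>v\<close> and its mate are reachable then fall into blossoms, each
  entered by exactly one residual unit arc \<open>e\<close> whose tail \<open>v\<close> is reachable while its mate is not:
  every regular trail into the blossom must use \<open>e\<close>.

  Optimality follows by LP duality. The potential \<open>[v reachable] - [v' reachable]\<close> drops along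
  a residual arc only where the arc crosses a blossom, and there the drop equals the
  characteristic function of the fragment formed by the blossom and the arcs entering it from
  once-reachable nodes. Since the flow saturates that fragment up to the single unit \<open>e\<close>, the
  fragment inequality is tight. An IS-flow has even inflow into every self-symmetric node set
  avoiding \<open>s\<close>; this gives oddness of these fragments as well as feasibility of IS-flows.\<close>

section \<open>Regular trails in a skew-symmetric digraph\<close>

text \<open>Stated for abstract arcs, to be instantiated by the unit arcs of the residual graph. No
  vertex set is fixed, so the vertex involution is required at arc ends only.\<close>

locale skew_digraph =
  fixes W :: "'w set" and src dst :: "'w \<Rightarrow> 'v" and m :: "'w \<Rightarrow> 'w"
    and sv :: "'v \<Rightarrow> 'v" and s :: 'v
  assumes m_in: "w \<in> W \<Longrightarrow> m w \<in> W"
    and m_neq: "w \<in> W \<Longrightarrow> m w \<noteq> w"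
    and m_m: "w \<in> W \<Longrightarrow> m (m w) = w"
    and src_m: "w \<in> W \<Longrightarrow> src (m w) = sv (dst w)"
    and dst_m: "w \<in> W \<Longrightarrow> dst (m w) = sv (src w)"
    and sv_src: "w \<in> W \<Longrightarrow> sv (sv (src w)) = src w"
    and sv_dst: "w \<in> W \<Longrightarrow> sv (sv (dst w)) = dst w"
begin

fun walk :: "'v \<Rightarrow> 'w list \<Rightarrow> 'v \<Rightarrow> bool" where
  "walk x [] y \<longleftrightarrow> x = y"
| "walk x (w # p) y \<longleftrightarrow> src w = x \<and> walk (dst w) p y"

lemma walk_append: "walk x (p @ q) y \<longleftrightarrow> (\<exists>z. walk x p z \<and> walk z q y)"
  by (induction p arbitrary: x) auto

definition regular :: "'w list \<Rightarrow> bool" where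
  "regular p \<longleftrightarrow> set p \<subseteq> W \<and> distinct p \<and> (\<forall>a\<in>set p. m a \<notin> set p)"

text \<open>Since \<open>m\<close> is an involution on \<open>W\<close>, the mate conditions from
  \<open>p\<close> to \<open>q\<close> and from \<open>q\<close> to \<open>p\<close> coincide, so
  one disjointness condition suffices.\<close>

lemma regular_append:
  "regular (p @ q) \<longleftrightarrow> regular p \<and> regular q \<and> set p \<inter> (set q \<union> m ` set q) = {}"
proof (cases "set p \<subseteq> W \<and> set q \<subseteq> W")
  case True
  then have "(\<forall>a\<in>set p. m a \<notin> set q) \<longleftrightarrow> set p \<inter> m ` set q = {}"
    and "(\<forall>a\<in>set q. m a \<notin> set p) \<longleftrightarrow> set p \<inter> m ` set q = {}"
    using m_m by (force, force)
  then show ?thesis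
    unfolding regular_def set_append distinct_append ball_Un Un_iff Un_subset_iff
      Int_Un_distrib Un_empty de_Morgan_disj ball_conj_distrib by argo
qed (auto simp: regular_def)

lemma regular_single: "regular [w] \<longleftrightarrow> w \<in> W"
  unfolding regular_def using m_neq by auto

text \<open>The skew symmetry reverses arcs, so the image of a walk is traversed backwards.\<close>

definition mirror :: "'w list \<Rightarrow> 'w list" where
  "mirror p = rev (map m p)"

lemma set_mirror: "set (mirror p) = m ` set p"
  by (simp add: mirror_def)

lemma walk_mirror: "set p \<subseteq> W \<Longrightarrow> walk x p y \<Longrightarrow> walk (sv y) (mirror p) (sv x)"
  by (induction p arbitrary: x) (auto simp: mirror_def walk_append src_m dst_m)

lemma regular_mirror: "regular p \<Longrightarrow> regular (mirror p)"
proof -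
  assume r: "regular p"
  then have W: "set p \<subseteq> W" by (simp add: regular_def)
  have "inj_on m (set p)"
    by (rule inj_on_inverseI[where g = m]) (use W m_m in auto)
  then show ?thesis
    using r W m_m m_in unfolding regular_def set_mirror
    by (auto simp: mirror_def distinct_map)
qed

section \<open>Reachability by regular trails\<close>

definition rtrail :: "'w list \<Rightarrow> 'v \<Rightarrow> bool" where
  "rtrail p v \<longleftrightarrow> regular p \<and> walk s p v"

definition reach :: "'v \<Rightarrow> bool" where
  "reach v \<longleftrightarrow> (\<exists>p. rtrail p v)"

definition once :: "'v \<Rightarrow> bool" where
  "once v \<longleftrightarrow> reach v \<and> \<not> reach (sv v)"

definition both :: "'v \<Rightarrow> bool" where
  "both v \<longleftrightarrow> reach v \<and> reach (sv v)"

text \<open>Vacuously true for an unreachable \<open>v\<close>; this is why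
  \<open>via_from_mate\<close> asks for \<open>reach (sv y)\<close>.\<close>

definition via :: "'w \<Rightarrow> 'v \<Rightarrow> bool" where
  "via e v \<longleftrightarrow> (\<forall>p. rtrail p v \<longrightarrow> e \<in> set p)"

lemma rtrail_in_W: "rtrail p v \<Longrightarrow> a \<in> set p \<Longrightarrow> a \<in> W"
  by (auto simp: rtrail_def regular_def)

text \<open>Prefixes of a regular trail are again regular trails from \<open>s\<close>, so both ends
  of each of its arcs are reachable.\<close>

lemma rtrail_split:
  assumes "rtrail p v" "a \<in> set p"
  obtains p1 p2 where "p = p1 @ a # p2" "rtrail p1 (src a)" "rtrail (p1 @ [a]) (dst a)"
    "walk (dst a) p2 v" "regular p2" "a \<notin> set p1"
proof -
  obtain p1 p2 where p: "p = p1 @ a # p2" "a \<notin> set p1"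
    using split_list_first[OF assms(2)] by auto
  have "p = (p1 @ [a]) @ p2" using p by simp
  then have "regular (p1 @ [a])" "regular p2" "regular p1"
    using assms(1) unfolding rtrail_def by (metis regular_append)+
  moreover have "walk s p1 (src a)" "walk (dst a) p2 v"
    using assms(1) unfolding rtrail_def p by (auto simp: walk_append)
  ultimately show ?thesis
    using p by (intro that[of p1 p2]) (auto simp: rtrail_def walk_append)
qed

lemma rtrail_snoc:
  assumes "rtrail p (src w)" "w \<in> W" "w \<notin> set p" "m w \<notin> set p"
  shows "rtrail (p @ [w]) (dst w)"
  using assms by (auto simp: rtrail_def regular_append regular_single walk_append)

text \<open>A regular trail to \<open>src w\<close> that cannot be extended by \<open>w\<close> must
  contain \<open>m w\<close>, since containing \<open>w\<close> would make \<open>dst w\<close>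
  reachable. And \<open>m w\<close> runs from the mate of \<open>dst w\<close> to the mate of
  \<open>src w\<close>.\<close>

lemma reach_step:
  assumes "w \<in> W" "reach (src w)" "\<not> reach (dst w)"
  shows "reach (sv (dst w)) \<and> reach (sv (src w))"
proof -
  obtain p where p: "rtrail p (src w)" using assms by (auto simp: reach_def)
  have "w \<notin> set p" using rtrail_split[OF p] assms(3) by (metis reach_def)
  then have "m w \<in> set p" using rtrail_snoc[OF p assms(1)] assms(3) by (auto simp: reach_def)
  then show ?thesis
    using rtrail_split[OF p] src_m[OF assms(1)] dst_m[OF assms(1)] by (metis reach_def)
qed

lemma once_step: "w \<in> W \<Longrightarrow> once (src w) \<Longrightarrow> reach (dst w)"
  using reach_step once_def by blast

lemma both_step: "w \<in> W \<Longrightarrow> both (src w) \<Longrightarrow> reach (dst w) \<or> reach (sv (dst w))"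
  using reach_step both_def by blast

lemma both_step_back: "w \<in> W \<Longrightarrow> both (dst w) \<Longrightarrow> reach (src w) \<or> reach (sv (src w))"
  using both_step[of "m w"] by (auto simp: m_in src_m dst_m both_def sv_src sv_dst)

text \<open>\<open>m e\<close> ends at the mate of \<open>src e\<close>, which is
  unreachable.\<close>

lemma mate_not_in_rtrail:
  assumes "e \<in> W" "once (src e)" "rtrail p v"
  shows "m e \<notin> set p"
proof
  assume "m e \<in> set p"
  then have "reach (dst (m e))" using rtrail_split[OF assms(3)] by (metis reach_def)
  then show False using assms dst_m by (simp add: once_def)
qed

text \<open>A regular trail to the tail of \<open>m e\<close> that avoids \<open>e\<close> could be
  extended by \<open>m e\<close>, which no regular trail contains.\<close>

lemma via_mate_head:
  assumes "e \<in> W" "once (src e)"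
  shows "via e (sv (dst e))"
  unfolding via_def
proof (intro allI impI)
  fix p assume p: "rtrail p (sv (dst e))"
  then have p': "rtrail p (src (m e))" using assms src_m by simp
  show "e \<in> set p"
  proof (rule ccontr)
    assume "e \<notin> set p"
    then have "rtrail (p @ [m e]) (dst (m e))"
      using rtrail_snoc[OF p'] mate_not_in_rtrail[OF assms p] assms m_in m_m by simp
    then show False using mate_not_in_rtrail[OF assms] by fastforce
  qed
qed

text \<open>The trail follows \<open>p\<close> up to its first contact with \<open>r\<close> or its mirror image,
  and then whichever of these two contains the contact arc.\<close>

lemma rtrail_switch:
  assumes p: "rtrail p y" and r: "regular r" "walk q r (sv y)" and y: "sv (sv y) = y"
  shows "\<exists>t. (rtrail t (sv y) \<or> rtrail t (sv q)) \<and> set t \<subseteq> set p \<union> set r \<union> m ` set r"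
proof -
  have rW: "set r \<subseteq> W" using r by (simp add: regular_def)
  have mr: "regular (mirror r)" "walk y (mirror r) (sv q)"
    using regular_mirror[OF r(1)] walk_mirror[OF rW r(2)] y by auto
  have mm: "m ` m ` set r = set r"
    using rW m_m by (force simp: image_image)
  \<comment> \<open>\<open>d\<close> will be \<open>r\<close> or its mirror image and
    \<open>c\<close> the contact arc. \<open>p1\<close> avoids the arcs of \<open>d\<close> and
    their mates, so it can be glued to the part of \<open>d\<close> from \<open>c\<close>
    on.\<close>
  have switch: "\<exists>t. rtrail t z \<and> set t \<subseteq> set p \<union> set d"
    if d: "regular d" "walk x d z" and pp: "p = p1 @ c # p2" and c: "c \<in> set d"
      and dis: "set p1 \<inter> (set d \<union> m ` set d) = {}" for d x z p1 c p2
  proof -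
    obtain d1 d2 where d12: "d = d1 @ c # d2" using split_list[OF c] by auto
    have "regular (c # d2)" using d(1) unfolding d12 regular_append by simp
    moreover have "regular p1" using p unfolding pp rtrail_def regular_append by simp
    moreover have "set p1 \<inter> (set (c # d2) \<union> m ` set (c # d2)) = {}"
      using dis unfolding d12 by auto
    ultimately have "regular (p1 @ c # d2)" unfolding regular_append by simp
    moreover have "walk s (p1 @ c # d2) z"
      using p d(2) unfolding pp d12 rtrail_def by (auto simp: walk_append)
    ultimately show ?thesis unfolding rtrail_def pp d12 by (intro exI[of _ "p1 @ c # d2"]) auto
  qed
  show ?thesis
  proof (cases "\<exists>c\<in>set p. c \<in> set r \<union> m ` set r")
    case True
    then obtain p1 c p2 where pp: "p = p1 @ c # p2" "c \<in> set r \<union> m ` set r"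
      and p1: "\<forall>b\<in>set p1. b \<notin> set r \<union> m ` set r"
      using split_list_first_prop[of p "\<lambda>c. c \<in> set r \<union> m ` set r"] by blast
    from pp(2) show ?thesis
    proof
      assume "c \<in> set r"
      then show ?thesis using switch[OF r pp(1)] p1 by blast
    next
      assume "c \<in> m ` set r"
      moreover have "set p1 \<inter> (set (mirror r) \<union> m ` set (mirror r)) = {}"
        unfolding set_mirror mm using p1 by blast
      ultimately show ?thesis using switch[OF mr pp(1)] unfolding set_mirror by blast
    qed
  next
    \<comment> \<open>Without contact, \<open>p\<close> continues along the whole mirror image,
      which starts at \<open>y\<close>.\<close>
    case False
    then have "set p \<inter> (set (mirror r) \<union> m ` set (mirror r)) = {}"
      unfolding set_mirror mm by blast
    then have "rtrail (p @ mirror r) (sv q)"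
      using p mr unfolding rtrail_def regular_append walk_append by blast
    then show ?thesis by (intro exI[of _ "p @ mirror r"]) (auto simp: set_mirror)
  qed
qed

text \<open>Let \<open>p\<close> reach \<open>y\<close> without \<open>e\<close>, and let
  \<open>r2\<close> be the part after \<open>e\<close> of a regular trail to \<open>sv y\<close>.
  Neither \<open>r2\<close> nor its mirror image contains \<open>e\<close>, so switching from
  \<open>p\<close> to one of them reaches \<open>sv y\<close> or \<open>sv (dst e)\<close> without
  \<open>e\<close>, against the hypothesis or \<open>via_mate_head\<close>.\<close>

lemma via_from_mate:
  assumes e: "e \<in> W" "once (src e)" and y: "sv (sv y) = y"
    and "reach (sv y)" "via e (sv y)"
  shows "via e y"
  unfolding via_def
proof (intro allI impI, rule ccontr)
  fix p assume p: "rtrail p y" "e \<notin> set p"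
  obtain r where r: "rtrail r (sv y)" using assms by (auto simp: reach_def)
  then have "e \<in> set r" using assms by (auto simp: via_def)
  with r obtain r1 r2 where r12: "r = r1 @ e # r2" "walk (dst e) r2 (sv y)" "regular r2"
    by (rule rtrail_split)
  have "e \<notin> set r2" using r r12 by (auto simp: rtrail_def regular_def)
  moreover have "e \<notin> m ` set r2"
  proof
    assume "e \<in> m ` set r2"
    then obtain c where "c \<in> set r2" "e = m c" by auto
    moreover from this have "c \<in> W" using rtrail_in_W[OF r] r12 by auto
    ultimately show False using mate_not_in_rtrail[OF e r] r12 m_m by auto
  qed
  ultimately show False
    using rtrail_switch[OF p(1) r12(3,2) y] p(2) \<open>via e (sv y)\<close> via_mate_head[OF e]
    unfolding via_def by blast
qed

section \<open>Domination by a single arc\<close>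

definition dominates :: "'w \<Rightarrow> 'v \<Rightarrow> bool" where
  "dominates e v \<longleftrightarrow> via e v \<and> via e (sv v)"

text \<open>A regular trail to \<open>sv (dst b)\<close> that avoids \<open>e\<close> contains
  neither \<open>b\<close> nor \<open>m b\<close>, as a prefix would reach \<open>src b\<close> or
  its mate without \<open>e\<close>. Extended by \<open>m b\<close> it reaches
  \<open>sv (src b)\<close> without \<open>e\<close>, a contradiction; \<open>via_from_mate\<close>
  gives the other half.\<close>

lemma dominates_step:
  assumes e: "e \<in> W" "once (src e)" and b: "b \<in> W" "both (src b)" "both (dst b)"
    and d: "dominates e (src b)"
  shows "dominates e (dst b)"
proof -
  have "both (src (m b))" using b src_m sv_dst by (auto simp: both_def)
  \<comment> \<open>\<open>e\<close> starts at a once-reachable node, \<open>b\<close> and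
    \<open>m b\<close> at twice-reachable ones.\<close>
  then have neq: "e \<noteq> b" "e \<noteq> m b" using e b by (auto simp: both_def once_def)
  have "via e (sv (dst b))"
    unfolding via_def
  proof (intro allI impI, rule ccontr)
    fix p assume p: "rtrail p (sv (dst b))" "e \<notin> set p"
    have "b \<notin> set p"
    proof
      assume "b \<in> set p"
      with p(1) obtain p1 p2 where "p = p1 @ b # p2" "rtrail p1 (src b)"
        by (rule rtrail_split)
      then show False using d p(2) by (auto simp: dominates_def via_def)
    qed
    moreover have "m b \<notin> set p"
    proof
      assume "m b \<in> set p"
      with p(1) obtain p1 p2 where "p = p1 @ m b # p2" "rtrail (p1 @ [m b]) (dst (m b))"
        by (rule rtrail_split)
      then show False using d p(2) neq dst_m b by (fastforce simp: dominates_def via_def)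
    qed
    ultimately have "rtrail (p @ [m b]) (sv (src b))"
      using rtrail_snoc[of p "m b"] p(1) b m_in m_m src_m dst_m by simp
    then show False using d p(2) neq by (fastforce simp: dominates_def via_def)
  qed
  moreover from this have "via e (dst b)"
    using via_from_mate[OF e] sv_dst b by (auto simp: both_def)
  ultimately show ?thesis by (simp add: dominates_def)
qed

lemma dominates_sv: "sv (sv v) = v \<Longrightarrow> dominates e (sv v) \<longleftrightarrow> dominates e v"
  by (auto simp: dominates_def)

section \<open>Blossoms and their entries\<close>

definition entry :: "'w \<Rightarrow> bool" where
  "entry e \<longleftrightarrow> e \<in> W \<and> once (src e) \<and> both (dst e)"

text \<open>The connected component of \<open>dst e\<close> among the twice-reachable nodes, with
  arc directions ignored and each node joined to its mate; empty unless \<open>e\<close> is an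
  entry.\<close>

inductive blossom :: "'w \<Rightarrow> 'v \<Rightarrow> bool" for e where
  base: "entry e \<Longrightarrow> blossom e (dst e)"
| mate: "blossom e v \<Longrightarrow> blossom e (sv v)"
| forward: "blossom e (src b) \<Longrightarrow> b \<in> W \<Longrightarrow> both (dst b) \<Longrightarrow> blossom e (dst b)"
| backward: "blossom e (dst b) \<Longrightarrow> b \<in> W \<Longrightarrow> both (src b) \<Longrightarrow> blossom e (src b)"

text \<open>\<open>via_mate_head\<close> starts the induction at \<open>dst e\<close>, and
  \<open>dominates_step\<close> carries it along arcs; going back over \<open>b\<close> is going
  forward over \<open>m b\<close>.\<close>

lemma blossomD:
  "blossom e v \<Longrightarrow> entry e \<and> both v \<and> sv (sv v) = v \<and> dominates e v"
proof (induction rule: blossom.induct)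
  case base
  then show ?case
    using via_mate_head via_from_mate sv_dst unfolding entry_def dominates_def both_def by blast
next
  case (mate v)
  then show ?case by (auto simp: both_def dominates_def)
next
  case (forward b)
  then show ?case using dominates_step sv_dst by (auto simp: entry_def)
next
  case (backward b)
  then have "dominates e (src (m b))" "both (src (m b))" "both (dst (m b))"
    by (auto simp: src_m dst_m both_def sv_src dominates_def)
  then have "dominates e (dst (m b))"
    using backward dominates_step[of e "m b"] m_in by (auto simp: entry_def)
  then show ?case using backward dst_m sv_src dominates_sv by auto
qed

lemma blossom_mate_iff: "sv (sv v) = v \<Longrightarrow> blossom e (sv v) \<longleftrightarrow> blossom e v"
  using blossom.mate by metis

text \<open>The closure rules are invertible, so the derivation of \<open>v\<close> from
  \<open>dst e\<close> can be retraced inside the blossom of \<open>e'\<close>.\<close>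

lemma blossom_connected:
  "blossom e v \<Longrightarrow> blossom e' v \<Longrightarrow> blossom e' (dst e)"
proof (induction rule: blossom.induct)
  case (mate v)
  then show ?case using blossomD blossom_mate_iff by blast
next
  case (forward b)
  then show ?case using blossomD blossom.backward by blast
next
  case (backward b)
  then show ?case using blossomD blossom.forward by blast
qed

text \<open>By connectedness each of two entries would dominate the head of the other. A shortest
  regular trail to \<open>src e\<close> avoids \<open>e\<close>; extended by \<open>e\<close> it
  must contain \<open>e'\<close>, so a prefix reaches \<open>dst e'\<close> without
  \<open>e\<close>.\<close>

lemma blossom_unique:
  assumes "blossom e v" "blossom e' v"
  shows "e = e'"
proof (rule ccontr)
  assume neq: "e \<noteq> e'"
  have e: "entry e" "entry e'" and via: "via e' (dst e)" "via e (dst e')"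
    using assms blossomD blossom_connected by (auto simp: dominates_def)
  obtain p0 where "rtrail p0 (src e)" using e by (auto simp: entry_def once_def reach_def)
  then obtain p where p: "rtrail p (src e)"
    and least: "\<And>q. rtrail q (src e) \<Longrightarrow> length p \<le> length q"
    using ex_has_least_nat[of "\<lambda>p. rtrail p (src e)" p0 length] by auto
  have notin: "e \<notin> set p"
  proof
    assume "e \<in> set p"
    with p obtain p1 p2 where "p = p1 @ e # p2" "rtrail p1 (src e)" by (rule rtrail_split)
    then show False using least[of p1] by simp
  qed
  then have "rtrail (p @ [e]) (dst e)"
    using rtrail_snoc[OF p] mate_not_in_rtrail[OF _ _ p] e by (auto simp: entry_def)
  then have "e' \<in> set p" using via(1) neq by (fastforce simp: via_def)
  with p obtain p1 p2 where "p = p1 @ e' # p2" "rtrail (p1 @ [e']) (dst e')"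
    by (rule rtrail_split)
  then show False using via(2) neq notin by (fastforce simp: via_def)
qed

lemma entry_into_blossom:
  assumes "w \<in> W" "once (src w)" "blossom e (dst w)"
  shows "w = e"
  using assms blossom_unique blossom.base blossomD unfolding entry_def by metis

section \<open>The potential and its descents\<close>

definition height :: "'v \<Rightarrow> real" where
  "height v = of_bool (reach v) - of_bool (reach (sv v))"

text \<open>The drops along \<open>w\<close> and \<open>m w\<close> are equal, and one of the two
  arcs starts at a once-reachable node. Its head is then reachable, and by the drop twice reachable,
  so this arc is an entry.\<close>

lemma descent_meets_blossom:
  assumes w: "w \<in> W" and d: "height (dst w) < height (src w)"
  shows "\<exists>e. blossom e (src w) \<or> blossom e (dst w)"
proof (cases "once (src w)")
  case True
  then have "both (dst w)" using d once_step[OF w] by (auto simp: both_def once_def height_def)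
  then show ?thesis using True w blossom.base[of w] by (auto simp: entry_def)
next
  case False
  then have *: "once (src (m w))"
    using d w by (auto simp: src_m once_def height_def sv_dst of_bool_def split: if_splits)
  then have "reach (sv (src w))" using once_step[of "m w"] w m_in dst_m by auto
  then have "both (dst (m w))"
    using d False w by (auto simp: dst_m both_def once_def height_def sv_src sv_dst of_bool_def split: if_splits)
  then have "blossom (m w) (sv (src w))"
    using blossom.base[of "m w"] * w m_in dst_m by (auto simp: entry_def)
  then show ?thesis using blossom_mate_iff[OF sv_src[OF w]] by blast
qed

text \<open>A twice-reachable head would be absorbed by the closure rules, and
  \<open>both_step\<close> makes the head or its mate reachable.\<close>

lemma leave_blossom:
  assumes w: "w \<in> W" and b: "blossom e (src w)" "\<not> blossom e (dst w)"
  shows "\<not> both (dst w)" "once (dst w) \<or> once (sv (dst w))"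
proof -
  show "\<not> both (dst w)" using assms blossom.forward by blast
  then show "once (dst w) \<or> once (sv (dst w))"
    using both_step[OF w] blossomD[OF b(1)] sv_dst[OF w] by (auto simp: once_def both_def)
qed

lemma enter_blossom:
  assumes w: "w \<in> W" and b: "blossom e (dst w)" "\<not> blossom e (src w)"
  shows "\<not> both (src w)" "once (src w) \<or> once (sv (src w))"
proof -
  show "\<not> both (src w)" using assms blossom.backward by blast
  then show "once (src w) \<or> once (sv (src w))"
    using both_step_back[OF w] blossomD[OF b(1)] sv_src[OF w] by (auto simp: once_def both_def)
qed

definition crosses :: "'w \<Rightarrow> 'w \<Rightarrow> bool" where
  "crosses e w \<longleftrightarrow> blossom e (src w) \<noteq> blossom e (dst w)"

text \<open>The outer end of a crossing arc is not twice reachable and so lies in no blossom; the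
  inner end lies in only one.\<close>

lemma crosses_unique:
  assumes "w \<in> W" "crosses e w" "crosses e' w"
  shows "e = e'"
  using assms leave_blossom(1) enter_blossom(1) blossomD blossom_unique
  unfolding crosses_def by metis

lemma height_blossom: "blossom e v \<Longrightarrow> height v = 0"
  using blossomD by (auto simp: height_def both_def)

text \<open>At most one summand is nonzero. Without a crossing there is no descent: it would need a
  blossom containing both ends, where the height is 0. The sum over entries is the form in which the
  fragments enter the dual bound.\<close>

lemma descent_le_crossing:
  assumes fin: "finite W" and w: "w \<in> W"
  shows "height (src w) - height (dst w)
    \<le> (\<Sum>e\<in>Collect entry. if crosses e w then height (src w) - height (dst w) else 0)"
proof (cases "\<exists>e. crosses e w")
  case True
  then obtain e where e: "crosses e w" by blast
  then have "entry e" using blossomD unfolding crosses_def by blast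
  moreover have "crosses e' w \<longleftrightarrow> e = e'" for e' using crosses_unique[OF w e] e by blast
  moreover have "finite (Collect entry)"
    using fin by (rule finite_subset[rotated]) (auto simp: entry_def)
  ultimately show ?thesis by simp
next
  case False
  then have "\<not> height (dst w) < height (src w)"
    using descent_meets_blossom[OF w] height_blossom unfolding crosses_def by fastforce
  then show ?thesis using False by simp
qed

lemma walk_telescope:
  fixes k :: "'v \<Rightarrow> real"
  shows "walk x p y \<Longrightarrow> (\<Sum>w\<leftarrow>p. k (src w) - k (dst w)) = k x - k y"
  by (induction p arbitrary: x) auto

end

section \<open>Involutions without fixed points\<close>

text \<open>A maximal set disjoint from its image covers \<open>A\<close>, since an uncovered
  element could be added to it.\<close>

lemma ex_half_involution:
  assumes "finite A" "\<And>x. x \<in> A \<Longrightarrow> i x \<in> A \<and> i x \<noteq> x \<and> i (i x) = x"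
  shows "\<exists>Z\<subseteq>A. Z \<inter> i ` Z = {} \<and> Z \<union> i ` Z = A"
proof -
  let ?Q = "{Z. Z \<subseteq> A \<and> Z \<inter> i ` Z = {}}"
  have "\<exists>Z\<in>?Q. \<forall>Y\<in>?Q. Z \<subseteq> Y \<longrightarrow> Z = Y"
    using assms(1) by (intro finite_has_maximal) auto
  then obtain Z where "Z \<in> ?Q" and mx': "\<forall>Y\<in>?Q. Z \<subseteq> Y \<longrightarrow> Z = Y" by (rule bexE)
  then have Z: "Z \<subseteq> A" "Z \<inter> i ` Z = {}" by simp_all
  have mx: "Y = Z" if "Y \<subseteq> A" "Y \<inter> i ` Y = {}" "Z \<subseteq> Y" for Y
    using mx'[rule_format, of Y] that by blast
  have "x \<in> Z \<union> i ` Z" if x: "x \<in> A" for x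
  proof (rule ccontr)
    assume n: "x \<notin> Z \<union> i ` Z"
    then have "i x \<notin> Z" using assms(2)[OF x] by (metis UnI2 imageI)
    moreover have "i x \<noteq> x" using assms(2)[OF x] by simp
    ultimately have "insert x Z \<inter> i ` insert x Z = {}" using n Z(2) by auto
    then have "insert x Z = Z" using mx[of "insert x Z"] x Z(1) by blast
    then show False using n by blast
  qed
  then show ?thesis using Z assms(2) by (intro exI[of _ Z]) auto
qed

lemma even_sum_involution:
  fixes F :: "'a \<Rightarrow> int"
  assumes "finite A" "\<And>x. x \<in> A \<Longrightarrow> i x \<in> A \<and> i x \<noteq> x \<and> i (i x) = x"
    and "\<And>x. x \<in> A \<Longrightarrow> F (i x) = F x"
  shows "even (sum F A)"
proof -
  obtain Z where Z: "Z \<subseteq> A" "Z \<inter> i ` Z = {}" "Z \<union> i ` Z = A"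
    using ex_half_involution[OF assms(1,2)] by blast
  have "inj_on i Z" by (rule inj_on_inverseI[where g = i]) (use Z assms(2) in auto)
  then have "sum F (i ` Z) = sum F Z"
    using Z(1) assms(3) by (auto simp: sum.reindex intro!: sum.cong)
  moreover have "sum F A = sum F Z + sum F (i ` Z)"
    using sum.union_disjoint[of Z "i ` Z" F] Z assms(1) finite_subset[OF Z(1)] by simp
  ultimately show ?thesis by simp
qed

section \<open>Net outflow and potentials in a network\<close>

locale skew_network =
  fixes V :: "'v set" and E :: "'e set" and tail head :: "'e \<Rightarrow> 'v"
    and sv :: "'v \<Rightarrow> 'v" and se :: "'e \<Rightarrow> 'e" and u :: "'e \<Rightarrow> nat" and s :: 'v
  assumes network: "skew_sym_network V E tail head sv se u s"
begin

lemma fin: "finite V" "finite E"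
  and ends: "a \<in> E \<Longrightarrow> tail a \<in> V" "a \<in> E \<Longrightarrow> head a \<in> V"
  and sv: "v \<in> V \<Longrightarrow> sv v \<in> V" "v \<in> V \<Longrightarrow> sv v \<noteq> v" "v \<in> V \<Longrightarrow> sv (sv v) = v"
  and se: "a \<in> E \<Longrightarrow> se a \<in> E" "a \<in> E \<Longrightarrow> se a \<noteq> a" "a \<in> E \<Longrightarrow> se (se a) = a"
  and ends_se: "a \<in> E \<Longrightarrow> tail (se a) = sv (head a)" "a \<in> E \<Longrightarrow> head (se a) = sv (tail a)"
  and u_se: "a \<in> E \<Longrightarrow> u (se a) = u a"
  and s_in: "s \<in> V"
  using network unfolding skew_sym_network_def by blast+

lemma bij_se: "bij_betw se E E"
  by (rule bij_betw_byWitness[where f' = se]) (use se in auto)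

text \<open>\<open>flow_value\<close> serves at every vertex \<open>v\<close> as the net outflow;
  the indicator form lets sums over vertices and arcs be exchanged.\<close>

lemma flow_value_eq:
  "flow_value E tail head v h = (\<Sum>a\<in>E. h a * (of_bool (tail a = v) - of_bool (head a = v)))"
proof -
  have "(\<Sum>a\<in>arcs_out E tail v. h a) = (\<Sum>a\<in>E. h a * of_bool (tail a = v))"
    and "(\<Sum>a\<in>arcs_in E head v. h a) = (\<Sum>a\<in>E. h a * of_bool (head a = v))"
    unfolding arcs_out_def arcs_in_def using fin(2)
    by (auto simp: of_bool_def if_distrib sum.If_cases Int_def cong: if_cong intro!: sum.cong)
  then show ?thesis by (simp add: flow_value_def right_diff_distrib sum_subtractf)
qed

text \<open>Summation by parts: an arc contributes only at its tail and its head.\<close>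

lemma sum_potential:
  "(\<Sum>v\<in>V. k v * flow_value E tail head v h) = (\<Sum>a\<in>E. h a * (k (tail a) - k (head a)))"
proof -
  have "(\<Sum>v\<in>V. k v * flow_value E tail head v h)
      = (\<Sum>a\<in>E. \<Sum>v\<in>V. k v * (h a * (of_bool (tail a = v) - of_bool (head a = v))))"
    unfolding flow_value_eq sum_distrib_left by (rule sum.swap)
  also have "\<dots> = (\<Sum>a\<in>E. h a * (k (tail a) - k (head a)))"
  proof (rule sum.cong[OF refl])
    fix a assume a: "a \<in> E"
    have "(\<Sum>v\<in>V. k v * of_bool (tail a = v)) = k (tail a)"
      and "(\<Sum>v\<in>V. k v * of_bool (head a = v)) = k (head a)"
      using ends[OF a] fin(1) by (simp_all add: of_bool_def if_distrib sum.delta cong: if_cong)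
    moreover have "(\<Sum>v\<in>V. k v * (h a * (of_bool (tail a = v) - of_bool (head a = v))))
       = h a * ((\<Sum>v\<in>V. k v * of_bool (tail a = v)) - (\<Sum>v\<in>V. k v * of_bool (head a = v)))"
      by (simp add: sum_distrib_left sum_subtractf[symmetric] algebra_simps)
    ultimately show "(\<Sum>v\<in>V. k v * (h a * (of_bool (tail a = v) - of_bool (head a = v))))
       = h a * (k (tail a) - k (head a))" by simp
  qed
  finally show ?thesis .
qed

text \<open>By conservation only \<open>s\<close> and its mate contribute, and the constant
  potential 1 shows that their net outflows are opposite.\<close>

lemma sum_potential_flow:
  assumes "\<forall>v\<in>V - {s, sv s}. flow_value E tail head v h = 0"
  shows "(\<Sum>a\<in>E. h a * (k (tail a) - k (head a)))
    = (k s - k (sv s)) * flow_value E tail head s h"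
proof -
  have *: "(\<Sum>v\<in>V. k v * flow_value E tail head v h)
      = k s * flow_value E tail head s h + k (sv s) * flow_value E tail head (sv s) h" for k
  proof -
    have "(\<Sum>v\<in>V. k v * flow_value E tail head v h)
        = (\<Sum>v\<in>{s, sv s}. k v * flow_value E tail head v h)"
      using assms s_in sv fin by (intro sum.mono_neutral_right) auto
    then show ?thesis using sv(2)[OF s_in] by simp
  qed
  have "flow_value E tail head (sv s) h = - flow_value E tail head s h"
    using sum_potential[of "\<lambda>_. 1" h] *[of "\<lambda>_. 1"] by simp
  then show ?thesis using sum_potential[of k h] *[of k] by (simp add: algebra_simps)
qed

end

section \<open>Symmetric integer flows and the parity of inflow\<close>

locale skew_flow = skew_network +
  fixes \<phi> :: "'b \<Rightarrow> nat"
  assumes \<phi>_le: "a \<in> E \<Longrightarrow> \<phi> a \<le> u a"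
    and \<phi>_se: "a \<in> E \<Longrightarrow> \<phi> (se a) = \<phi> a"
    and \<phi>_conserved: "\<forall>v\<in>V - {s, sv s}. flow_value E tail head v (\<lambda>a. real (\<phi> a)) = 0"
begin

definition entering :: "'a set \<Rightarrow> 'b set" where
  "entering C = {a \<in> E. tail a \<notin> C \<and> head a \<in> C}"

text \<open>With \<open>C\<close> split as \<open>Z \<union> sv ` Z\<close>, conservation on \<open>Z\<close> and symmetry express the inflow
  modulo 2 through arcs joining \<open>Z\<close> with \<open>sv ` Z\<close>, which come in pairs of mates.\<close>

lemma even_inflow:
  assumes C: "C \<subseteq> V" "sv ` C = C" "s \<notin> C"
  shows "even (\<Sum>a\<in>entering C. int (\<phi> a))"
proof -
  have svC: "sv v \<in> C \<longleftrightarrow> v \<in> C" if "v \<in> V" for v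
    using C(1,2) sv(3)[OF that] by (metis imageI)
  have "\<exists>Z\<subseteq>C. Z \<inter> sv ` Z = {} \<and> Z \<union> sv ` Z = C"
    by (rule ex_half_involution) (use finite_subset[OF C(1) fin(1)] C(1) svC sv in auto)
  then obtain Z where Z: "Z \<subseteq> C" "Z \<inter> sv ` Z = {}" "Z \<union> sv ` Z = C"
    by (elim exE conjE)
  have svZ: "sv v \<in> Z \<longleftrightarrow> v \<in> C \<and> v \<notin> Z" if v: "v \<in> V" for v
  proof -
    have "v \<in> sv ` Z \<longleftrightarrow> sv v \<in> Z"
      using sv(3) v Z(1) C(1) by (metis imageE imageI in_mono)
    then show ?thesis using Z by blast
  qed
  have s: "s \<notin> Z" "sv s \<notin> Z" using Z(1) C(3) svC[OF s_in] by blast+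
  \<comment> \<open>Conservation summed over \<open>Z\<close>, with the indicator of
    \<open>Z\<close> as potential; neither \<open>s\<close> nor its mate lies in
    \<open>Z\<close>.\<close>
  have "real_of_int (\<Sum>a\<in>E. int (\<phi> a) * (of_bool (tail a \<in> Z) - of_bool (head a \<in> Z))) = 0"
    using sum_potential_flow[OF \<phi>_conserved, of "\<lambda>v. of_bool (v \<in> Z)"] s by simp
  then have cons: "(\<Sum>a\<in>E. int (\<phi> a) * (of_bool (tail a \<in> Z) - of_bool (head a \<in> Z))) = 0"
    by linarith
  \<comment> \<open>Mates exchange the arcs entering \<open>C\<close> with head in
    \<open>C - Z\<close> and the arcs leaving \<open>C\<close> from \<open>Z\<close>.\<close>
  have "(\<Sum>a\<in>E. int (\<phi> a) * of_bool (tail a \<notin> C \<and> head a \<in> C - Z))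
     = (\<Sum>a\<in>E. int (\<phi> (se a)) * of_bool (tail (se a) \<notin> C \<and> head (se a) \<in> C - Z))"
    by (rule sum.reindex_bij_betw[OF bij_se, symmetric])
  also have "\<dots> = (\<Sum>a\<in>E. int (\<phi> a) * of_bool (head a \<notin> C \<and> tail a \<in> Z))"
    using ends svC svZ Z(1) by (intro sum.cong) (auto simp: \<phi>_se ends_se)
  finally have swap: "(\<Sum>a\<in>E. int (\<phi> a) * of_bool (tail a \<notin> C \<and> head a \<in> C - Z))
     = (\<Sum>a\<in>E. int (\<phi> a) * of_bool (head a \<notin> C \<and> tail a \<in> Z))" .
  let ?P = "\<lambda>a. int (\<phi> a) * (of_bool (tail a \<in> Z \<and> head a \<in> C - Z)
    - of_bool (tail a \<in> C - Z \<and> head a \<in> Z))"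
  have "(\<Sum>a\<in>entering C. int (\<phi> a)) = (\<Sum>a\<in>E. int (\<phi> a) * of_bool (tail a \<notin> C \<and> head a \<in> C))"
    unfolding entering_def using fin(2)
    by (auto simp: of_bool_def if_distrib sum.If_cases Int_def cong: if_cong intro!: sum.cong)
  also have "\<dots> = (\<Sum>a\<in>E. int (\<phi> a) * of_bool (tail a \<notin> C \<and> head a \<in> Z))
      + (\<Sum>a\<in>E. int (\<phi> a) * of_bool (tail a \<notin> C \<and> head a \<in> C - Z))"
    unfolding sum.distrib[symmetric] using Z(1) by (intro sum.cong) auto
  \<comment> \<open>The zero net outflow of \<open>Z\<close> is added: it cancels the arcs entering
    \<open>Z\<close> from outside \<open>C\<close> and doubles those leaving \<open>C\<close> from
    \<open>Z\<close>.\<close>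
  also have "\<dots> = (\<Sum>a\<in>E. int (\<phi> a) * of_bool (tail a \<notin> C \<and> head a \<in> Z))
      + (\<Sum>a\<in>E. int (\<phi> a) * of_bool (head a \<notin> C \<and> tail a \<in> Z))
      + (\<Sum>a\<in>E. int (\<phi> a) * (of_bool (tail a \<in> Z) - of_bool (head a \<in> Z)))"
    unfolding cons swap by simp
  also have "\<dots> = 2 * (\<Sum>a\<in>E. int (\<phi> a) * of_bool (head a \<notin> C \<and> tail a \<in> Z)) + sum ?P E"
    unfolding sum.distrib[symmetric] sum_distrib_left using Z(1) by (intro sum.cong) auto
  finally have eq: "(\<Sum>a\<in>entering C. int (\<phi> a))
     = 2 * (\<Sum>a\<in>E. int (\<phi> a) * of_bool (head a \<notin> C \<and> tail a \<in> Z)) + sum ?P E" .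
  \<comment> \<open>The mate of an arc from \<open>Z\<close> to \<open>C - Z\<close> again runs from
    \<open>Z\<close> to \<open>C - Z\<close>, and likewise in the other direction.\<close>
  have "even (sum ?P E)"
    by (rule even_sum_involution[OF fin(2), of se])
      (use ends svC svZ Z(1) in \<open>auto simp: se \<phi>_se ends_se\<close>)
  then show ?thesis unfolding eq by simp
qed

text \<open>Mates map the entering arcs one-to-one onto the leaving arcs and preserve flow and
  characteristic function, so each entering arc counts twice.\<close>

lemma sum_frag_char:
  assumes C: "C \<subseteq> V" "sv ` C = C" and U: "U \<subseteq> entering C"
  shows "(\<Sum>a\<in>E. real (\<phi> a) * frag_char E tail head se C U a)
    = 2 * (real (\<Sum>a\<in>U. \<phi> a) - real (\<Sum>a\<in>entering C - U. \<phi> a))"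
proof -
  have svC: "sv v \<in> C \<longleftrightarrow> v \<in> C" if "v \<in> V" for v
    using C(1,2) sv(3)[OF that] by (metis imageI)
  let ?\<chi> = "frag_char E tail head se C U"
  have UE: "U \<subseteq> E" and fe: "finite (entering C)"
    using U fin(2) by (auto simp: entering_def)
  have inj: "inj_on se (entering C)"
    by (rule inj_on_inverseI[where g = se]) (auto simp: se entering_def)
  have seU: "se a \<in> se ` U \<longleftrightarrow> a \<in> U" if "a \<in> E" for a
    using that UE se(3) by (metis imageE imageI in_mono)
  have eE: "a \<in> E \<and> tail a \<notin> C \<and> head a \<in> C" if "a \<in> entering C" for a
    using that by (auto simp: entering_def)
  have leave: "se a \<in> E \<and> tail (se a) \<in> C \<and> head (se a) \<notin> C" if "a \<in> entering C" for a
    using eE[OF that] se ends ends_se svC by simp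
  have \<chi>1: "?\<chi> a = (if a \<in> U then 1 else -1)" if a: "a \<in> entering C" for a
  proof -
    have "a \<notin> se ` U" using eE[OF a] leave U by blast
    then show ?thesis using eE[OF a] by (auto simp: frag_char_def cut_arcs_def)
  qed
  have \<chi>2: "?\<chi> (se a) = (if a \<in> U then 1 else -1)" if a: "a \<in> entering C" for a
  proof -
    have "se a \<notin> U" using leave[OF a] U eE by blast
    then show ?thesis using eE[OF a] leave[OF a] seU by (auto simp: frag_char_def cut_arcs_def)
  qed
  have \<chi>0: "?\<chi> a = 0" if a: "a \<in> E - (entering C \<union> se ` entering C)" for a
  proof -
    have "a \<notin> cut_arcs E tail head C"
    proof
      assume "a \<in> cut_arcs E tail head C"
      then have "tail a \<in> C" "head a \<notin> C" using a by (auto simp: cut_arcs_def entering_def)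
      then have "se a \<in> entering C" using a se ends ends_se svC by (auto simp: entering_def)
      then show False using a se(3)[of a] by (metis DiffD1 DiffD2 UnI2 imageI)
    qed
    then show ?thesis using a U by (auto simp: frag_char_def)
  qed
  have "(\<Sum>a\<in>E. real (\<phi> a) * ?\<chi> a) = (\<Sum>a\<in>entering C \<union> se ` entering C. real (\<phi> a) * ?\<chi> a)"
    using fin(2) \<chi>0 eE leave by (intro sum.mono_neutral_right) auto
  also have "\<dots> = (\<Sum>a\<in>entering C. real (\<phi> a) * ?\<chi> a) + (\<Sum>a\<in>se ` entering C. real (\<phi> a) * ?\<chi> a)"
    using fe eE leave by (intro sum.union_disjoint) blast+
  also have "\<dots> = (\<Sum>a\<in>entering C. real (\<phi> a) * ?\<chi> a)
      + (\<Sum>a\<in>entering C. real (\<phi> (se a)) * ?\<chi> (se a))"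
    using inj by (simp add: sum.reindex)
  also have "\<dots> = (\<Sum>a\<in>entering C. 2 * (real (\<phi> a) * (if a \<in> U then 1 else -1)))"
    unfolding sum.distrib[symmetric] using \<chi>1 \<chi>2 eE \<phi>_se by (intro sum.cong) auto
  also have "\<dots> = 2 * ((\<Sum>a\<in>U. real (\<phi> a)) - (\<Sum>a\<in>entering C - U. real (\<phi> a)))"
  proof -
    have "(\<Sum>a\<in>entering C. real (\<phi> a) * (if a \<in> U then 1 else -1))
       = (\<Sum>a\<in>entering C - U. real (\<phi> a) * (if a \<in> U then 1 else -1))
         + (\<Sum>a\<in>U. real (\<phi> a) * (if a \<in> U then 1 else -1))"
      using U fe by (rule sum.subset_diff)
    then show ?thesis by (simp add: sum_distrib_left[symmetric] sum_negf)
  qed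
  finally show ?thesis by simp
qed

text \<open>Modulo 2 the difference is the whole inflow into \<open>C\<close>.\<close>

lemma even_fragment_balance:
  assumes "C \<subseteq> V" "sv ` C = C" "s \<notin> C" "U \<subseteq> entering C"
  shows "even ((\<Sum>a\<in>U. int (\<phi> a)) - (\<Sum>a\<in>entering C - U. int (\<phi> a)))"
proof -
  have "finite (entering C)" using fin(2) by (auto simp: entering_def)
  then have "(\<Sum>a\<in>entering C. int (\<phi> a))
      = (\<Sum>a\<in>entering C - U. int (\<phi> a)) + (\<Sum>a\<in>U. int (\<phi> a))"
    using assms(4) by (intro sum.subset_diff)
  then show ?thesis using even_inflow[OF assms(1-3)] by simp
qed

text \<open>The balance \<open>b\<close> is even and at most the odd capacity of \<open>U\<close>,
  hence smaller by at least 1; \<open>sum_frag_char\<close> doubles this.\<close>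

lemma fragment_inequality:
  assumes "odd_fragment V E tail head sv u s C U"
  shows "(\<Sum>a\<in>E. real (\<phi> a) * frag_char E tail head se C U a) \<le> 2 * real (\<Sum>a\<in>U. u a) - 2"
proof -
  have C: "C \<subseteq> V" "sv ` C = C" "s \<notin> C" "U \<subseteq> entering C" and odd: "odd (\<Sum>a\<in>U. u a)"
    using assms by (auto simp: odd_fragment_def entering_def)
  define b where "b = (\<Sum>a\<in>U. int (\<phi> a)) - (\<Sum>a\<in>entering C - U. int (\<phi> a))"
  have "(\<Sum>a\<in>U. int (\<phi> a)) \<le> (\<Sum>a\<in>U. int (u a))"
    using C(4) \<phi>_le by (intro sum_mono) (auto simp: entering_def)
  moreover have "0 \<le> (\<Sum>a\<in>entering C - U. int (\<phi> a))" by (simp add: sum_nonneg)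
  moreover have "(\<Sum>a\<in>U. int (u a)) = int (\<Sum>a\<in>U. u a)" by simp
  ultimately have "b \<le> int (\<Sum>a\<in>U. u a)" unfolding b_def by linarith
  moreover have "even b" unfolding b_def by (rule even_fragment_balance[OF C])
  then have "b \<noteq> int (\<Sum>a\<in>U. u a)" using odd by (metis even_of_nat_iff)
  ultimately have "real_of_int b \<le> real (\<Sum>a\<in>U. u a) - 1" by linarith
  moreover have "real_of_int b = real (\<Sum>a\<in>U. \<phi> a) - real (\<Sum>a\<in>entering C - U. \<phi> a)"
    by (simp add: b_def)
  ultimately show ?thesis using sum_frag_char[OF C(1,2,4)] by simp
qed

section \<open>The residual graph of unit arcs\<close>

text \<open>\<open>(a, True, i)\<close> is the \<open>i\<close>-th unit of unused capacity of \<open>a\<close>, and \<open>(a, False, i)\<close> the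
  \<open>i\<close>-th flow unit on \<open>a\<close>, traversed backwards.\<close>

definition units :: "('b \<times> bool \<times> nat) set" where
  "units = {(a, b, i). a \<in> E \<and> i < (if b then u a - \<phi> a else \<phi> a)}"

fun unit_src :: "'b \<times> bool \<times> nat \<Rightarrow> 'a" where
  "unit_src (a, b, i) = (if b then tail a else head a)"

fun unit_dst :: "'b \<times> bool \<times> nat \<Rightarrow> 'a" where
  "unit_dst (a, b, i) = (if b then head a else tail a)"

text \<open>Direction and index are kept: \<open>u\<close> and \<open>\<phi>\<close> are symmetric,
  so \<open>a\<close> and \<open>se a\<close> have equally many units of each kind.\<close>

fun unit_mate :: "'b \<times> bool \<times> nat \<Rightarrow> 'b \<times> bool \<times> nat" where
  "unit_mate (a, b, i) = (se a, b, i)"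

sublocale residual: skew_digraph units unit_src unit_dst unit_mate sv s
  by unfold_locales (auto simp: units_def se u_se \<phi>_se ends ends_se sv)

lemma finite_units: "finite units"
proof -
  have "units \<subseteq> (SIGMA a:E. UNIV \<times> {..<u a + \<phi> a})"
    by (auto simp: units_def split: if_splits)
  then show ?thesis by (rule finite_subset) (use fin(2) in auto)
qed

lemma walk_in_V: "set p \<subseteq> units \<Longrightarrow> residual.walk x p y \<Longrightarrow> x \<in> V \<Longrightarrow> y \<in> V"
  by (induction p arbitrary: x) (auto simp: units_def ends)

lemma reach_in_V: "residual.reach v \<Longrightarrow> v \<in> V"
  using walk_in_V s_in
  by (auto simp: residual.reach_def residual.rtrail_def residual.regular_def)

section \<open>Fragments formed by blossoms\<close>

definition frag_set :: "'b \<times> bool \<times> nat \<Rightarrow> 'a set" where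
  "frag_set e = {v. residual.blossom e v}"

text \<open>Ranges over all arcs of the network, including saturated ones, which have no forward
  residual unit.\<close>

definition frag_arcs :: "'b \<times> bool \<times> nat \<Rightarrow> 'b set" where
  "frag_arcs e = {a \<in> E. residual.once (tail a) \<and> residual.blossom e (head a)}"

lemma frag_set_sv: "v \<in> V \<Longrightarrow> residual.blossom e (sv v) \<longleftrightarrow> residual.blossom e v"
  using residual.blossom_mate_iff sv by blast

lemma once_not_blossom: "residual.once v \<Longrightarrow> \<not> residual.blossom e v"
  and once_sv_not_blossom: "v \<in> V \<Longrightarrow> residual.once (sv v) \<Longrightarrow> \<not> residual.blossom e v"
  using residual.blossomD sv(3) unfolding residual.once_def residual.both_def by metis+

lemma frag_shape:
  assumes "\<not> residual.reach (sv s)"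
  shows "frag_set e \<subseteq> V" "sv ` frag_set e = frag_set e" "s \<notin> frag_set e"
    "frag_arcs e \<subseteq> entering (frag_set e)"
proof -
  show V: "frag_set e \<subseteq> V"
    using residual.blossomD[of e] reach_in_V by (auto simp: frag_set_def residual.both_def)
  have cl: "sv ` frag_set e \<subseteq> frag_set e"
    using residual.blossom.mate[of e] by (auto simp: frag_set_def)
  moreover have "v \<in> sv ` frag_set e" if v: "v \<in> frag_set e" for v
    by (rule image_eqI[of _ _ "sv v"]) (use v V cl sv(3) in auto)
  ultimately show "sv ` frag_set e = frag_set e" by blast
  show "s \<notin> frag_set e"
    using residual.blossomD[of e] assms by (auto simp: frag_set_def residual.both_def)
  show "frag_arcs e \<subseteq> entering (frag_set e)"
    using once_not_blossom[of _ e] by (auto simp: frag_arcs_def frag_set_def entering_def)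
qed

text \<open>At a crossing arc the inner end has height 0 and the outer end 1 or -1, by
  \<open>leave_blossom\<close> and \<open>enter_blossom\<close>. The difference is 1 exactly on
  \<open>frag_arcs e\<close> and its mates. It is taken along \<open>a\<close> whichever way the
  unit points.\<close>

lemma frag_char_unit:
  assumes w: "(a, b, i) \<in> units"
  shows "frag_char E tail head se (frag_set e) (frag_arcs e) a
    = (if residual.crosses e (a, b, i)
       then residual.height (tail a) - residual.height (head a) else 0)"
proof -
  let ?B = "residual.blossom e"
  have a: "a \<in> E" using w by (simp add: units_def)
  note V = ends[OF a]
  have cross: "residual.crosses e (a, b, i) \<longleftrightarrow> ?B (tail a) \<noteq> ?B (head a)"
    by (cases b) (auto simp: residual.crosses_def)
  have seU: "a \<in> se ` frag_arcs e \<longleftrightarrow> residual.once (sv (head a)) \<and> ?B (tail a)"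
  proof -
    have "a \<in> se ` frag_arcs e \<longleftrightarrow> se a \<in> frag_arcs e"
      using se(3) a by (auto simp: frag_arcs_def intro: rev_image_eqI)
    then show ?thesis using a V by (simp add: frag_arcs_def se ends_se frag_set_sv)
  qed
  have U: "a \<in> frag_arcs e \<longleftrightarrow> residual.once (tail a) \<and> ?B (head a)"
    using a by (simp add: frag_arcs_def)
  have cut: "a \<in> cut_arcs E tail head (frag_set e) \<longleftrightarrow> ?B (tail a) \<noteq> ?B (head a)"
    using a by (simp add: cut_arcs_def frag_set_def)
  have height: "residual.height v = (if residual.once v then 1 else -1)"
    if "residual.once v \<or> residual.once (sv v)" "v \<in> V" for v
    using that sv(3) by (auto simp: residual.once_def residual.height_def)
  have excl: "\<not> (residual.once v \<and> residual.once (sv v))" for v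
    by (auto simp: residual.once_def)
  consider "?B (tail a)" "\<not> ?B (head a)" | "\<not> ?B (tail a)" "?B (head a)"
    | "?B (tail a) \<longleftrightarrow> ?B (head a)" by blast
  then show ?thesis
  proof cases
    case 1
    then have o: "residual.once (head a) \<or> residual.once (sv (head a))"
      using residual.leave_blossom(2)[OF w, of e] residual.enter_blossom(2)[OF w, of e]
      by (cases b) auto
    then show ?thesis
      using 1 height[OF o V(2)] excl[of "head a"] residual.height_blossom[OF 1(1)]
        once_not_blossom[of "tail a" e]
      unfolding frag_char_def cross Un_iff seU U cut by auto
  next
    case 2
    then have o: "residual.once (tail a) \<or> residual.once (sv (tail a))"
      using residual.leave_blossom(2)[OF w, of e] residual.enter_blossom(2)[OF w, of e]
      by (cases b) auto
    then show ?thesis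
      using 2 height[OF o V(1)] excl[of "tail a"] residual.height_blossom[OF 2(2)]
      unfolding frag_char_def cross Un_iff seU U cut by auto
  next
    case 3
    then show ?thesis
      using once_not_blossom[of "tail a" e] once_sv_not_blossom[OF V(2), of e]
      unfolding frag_char_def cross Un_iff seU U cut by auto
  qed
qed

text \<open>The left-hand side counts residual units; each of them is the entry \<open>e\<close> or its mate,
  and exactly one of these two is counted.\<close>

lemma frag_slack:
  assumes e: "residual.entry e"
  shows "(\<Sum>a\<in>frag_arcs e. u a - \<phi> a) + (\<Sum>a\<in>entering (frag_set e) - frag_arcs e. \<phi> a) = 1"
proof -
  let ?U = "frag_arcs e" and ?D = "entering (frag_set e) - frag_arcs e"
  let ?S = "(SIGMA a:?U. {True} \<times> {..<u a - \<phi> a})" and ?T = "(SIGMA a:?D. {False} \<times> {..<\<phi> a})"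
  have eW: "e \<in> units" and once: "residual.once (unit_src e)"
    and B: "residual.blossom e (unit_dst e)"
    using e residual.blossom.base by (auto simp: residual.entry_def)
  obtain a0 b0 i0 where ee: "e = (a0, b0, i0)" by (cases e)
  have a0: "a0 \<in> E" and i0: "i0 < (if b0 then u a0 - \<phi> a0 else \<phi> a0)"
    using eW by (auto simp: ee units_def)
  \<comment> \<open>If \<open>e\<close> is a backward unit, its arc \<open>a0\<close> leaves the
    blossom, so the entering arc that is counted is \<open>se a0\<close>.\<close>
  define e' where "e' = (if b0 then e else unit_mate e)"
  have fU: "finite ?U" "finite ?D" using fin(2) by (auto simp: frag_arcs_def entering_def)
  have S: "w = e'" if "w \<in> ?S" for w
  proof -
    obtain a i where w: "w = (a, True, i)" "a \<in> ?U" "i < u a - \<phi> a" using \<open>w \<in> ?S\<close> by auto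
    then have "w = e"
      by (intro residual.entry_into_blossom) (auto simp: units_def frag_arcs_def)
    then show ?thesis using w by (simp add: ee e'_def)
  qed
  have T: "w = e'" if "w \<in> ?T" for w
  proof -
    obtain a i where w: "w = (a, False, i)" "a \<in> ?D" "i < \<phi> a" using \<open>w \<in> ?T\<close> by auto
    then have a: "a \<in> E" "\<not> residual.blossom e (tail a)" "residual.blossom e (head a)"
      "\<not> residual.once (tail a)"
      by (auto simp: entering_def frag_set_def frag_arcs_def)
    have wu: "w \<in> units" using w a by (simp add: units_def)
    \<comment> \<open>The backward unit \<open>w\<close> leaves the blossom, so its mate enters it,
      from a once-reachable node, and must be the entry.\<close>
    then have "residual.once (sv (tail a))"
      using residual.leave_blossom(2)[OF wu, of e] w a by simp
    then have "unit_mate w = e"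
      using residual.m_in[OF wu] a w
      by (intro residual.entry_into_blossom) (auto simp: ends_se frag_set_sv ends)
    then have "w = unit_mate e" using residual.m_m[OF wu] by simp
    then show ?thesis using w by (cases b0) (auto simp: ee e'_def)
  qed
  have "e' \<in> ?S \<union> ?T"
  proof (cases b0)
    case True
    then show ?thesis using once B a0 i0 by (simp add: ee e'_def frag_arcs_def)
  next
    case False
    then have "residual.once (head a0)" "residual.blossom e (tail a0)"
      using once B by (auto simp: ee)
    moreover from this have "\<not> residual.once (sv (head a0))" "\<not> residual.blossom e (head a0)"
      using once_not_blossom[of "head a0" e] by (auto simp: residual.once_def)
    ultimately show ?thesis
      using False a0 i0
      by (simp add: ee e'_def entering_def frag_set_def frag_arcs_def ends_se frag_set_sv ends se \<phi>_se)
  qed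
  then have "?S \<union> ?T = {e'}" using S T by blast
  then have "card (?S \<union> ?T) = 1" by simp
  moreover have "card (?S \<union> ?T) = card ?S + card ?T"
    using fU by (intro card_Un_disjoint) auto
  moreover have "card ?S = (\<Sum>a\<in>?U. u a - \<phi> a)" "card ?T = (\<Sum>a\<in>?D. \<phi> a)"
    using fU by (simp_all add: card_cartesian_product)
  ultimately show ?thesis by simp
qed

text \<open>Slack 1 means that the balance is the capacity of \<open>frag_arcs e\<close> minus 1. As
  the balance is even, this capacity is odd, and doubling the balance gives equality.\<close>

lemma frag_tight:
  assumes e: "residual.entry e" and nr: "\<not> residual.reach (sv s)"
  shows "odd_fragment V E tail head sv u s (frag_set e) (frag_arcs e)"
    and "(\<Sum>a\<in>E. real (\<phi> a) * frag_char E tail head se (frag_set e) (frag_arcs e) a)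
      = 2 * real (\<Sum>a\<in>frag_arcs e. u a) - 2"
proof -
  note F = frag_shape[OF nr, of e]
  have "int ((\<Sum>a\<in>frag_arcs e. u a - \<phi> a) + (\<Sum>a\<in>entering (frag_set e) - frag_arcs e. \<phi> a)) = 1"
    unfolding frag_slack[OF e] by simp
  moreover have "(\<Sum>a\<in>frag_arcs e. int (u a - \<phi> a))
      = (\<Sum>a\<in>frag_arcs e. int (u a)) - (\<Sum>a\<in>frag_arcs e. int (\<phi> a))"
    unfolding sum_subtractf[symmetric] using \<phi>_le
    by (intro sum.cong) (auto simp: frag_arcs_def of_nat_diff)
  ultimately have eq: "(\<Sum>a\<in>frag_arcs e. int (\<phi> a))
      - (\<Sum>a\<in>entering (frag_set e) - frag_arcs e. int (\<phi> a)) = (\<Sum>a\<in>frag_arcs e. int (u a)) - 1"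
    by simp
  have "odd (\<Sum>a\<in>frag_arcs e. int (u a))"
    using even_fragment_balance[OF F] unfolding eq by simp
  then have "odd (\<Sum>a\<in>frag_arcs e. u a)" by (metis even_of_nat_iff of_nat_sum)
  then show "odd_fragment V E tail head sv u s (frag_set e) (frag_arcs e)"
    using F by (simp add: odd_fragment_def entering_def)
  have "real (\<Sum>a\<in>frag_arcs e. \<phi> a) - real (\<Sum>a\<in>entering (frag_set e) - frag_arcs e. \<phi> a)
      = real (\<Sum>a\<in>frag_arcs e. u a) - 1"
    using arg_cong[OF eq, of real_of_int] by simp
  then show "(\<Sum>a\<in>E. real (\<phi> a) * frag_char E tail head se (frag_set e) (frag_arcs e) a)
      = 2 * real (\<Sum>a\<in>frag_arcs e. u a) - 2"
    using sum_frag_char[OF F(1,2,4)] by simp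
qed

section \<open>The dual bound\<close>

text \<open>The height drops by 2 from \<open>s\<close> to its mate, so twice the difference in
  value is the sum of \<open>g - \<phi>\<close> times the descent. Replacing descents by
  characteristic functions can only increase it, and then \<open>g\<close> obeys each fragment
  inequality while \<open>\<phi>\<close> attains it.\<close>

lemma lp_bound:
  assumes nr: "\<not> residual.reach (sv s)" and g: "lp_feasible V E tail head sv se u s g"
  shows "flow_value E tail head s g \<le> flow_value E tail head s (\<lambda>a. real (\<phi> a))"
proof -
  let ?h = "residual.height" and ?N = "Collect residual.entry"
  let ?\<chi> = "\<lambda>e. frag_char E tail head se (frag_set e) (frag_arcs e)"
  have "residual.reach s"
    unfolding residual.reach_def residual.rtrail_def by (intro exI[of _ "[]"]) (simp add: residual.regular_def)
  then have h: "?h s - ?h (sv s) = 2"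
    using nr sv(3)[OF s_in] by (simp add: residual.height_def)
  have bounds: "0 \<le> g a" "g a \<le> real (u a)" if "a \<in> E" for a
    using g that by (auto simp: lp_feasible_def)
  have cg: "\<forall>v\<in>V - {s, sv s}. flow_value E tail head v g = 0"
    using g by (simp add: lp_feasible_def flow_value_def)
  \<comment> \<open>Where \<open>g\<close> exceeds \<open>\<phi>\<close> there is a forward unit,
    whose descent bound applies; where \<open>g\<close> is smaller there is a backward unit, and
    both signs flip.\<close>
  have point: "(g a - real (\<phi> a)) * (?h (tail a) - ?h (head a))
      \<le> (g a - real (\<phi> a)) * (\<Sum>e\<in>?N. ?\<chi> e a)" if a: "a \<in> E" for a
  proof (cases "g a" "real (\<phi> a)" rule: linorder_cases)
    case greater
    then have w: "(a, True, 0) \<in> units" using bounds[OF a] a by (auto simp: units_def)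
    have "?h (tail a) - ?h (head a) \<le> (\<Sum>e\<in>?N. ?\<chi> e a)"
      using residual.descent_le_crossing[OF finite_units w] by (simp add: frag_char_unit[OF w] cong: if_cong)
    then show ?thesis using greater by (intro mult_left_mono) auto
  next
    case less
    then have w: "(a, False, 0) \<in> units" using bounds[OF a] a by (auto simp: units_def)
    have "?h (head a) - ?h (tail a) \<le>
        (\<Sum>e\<in>?N. if residual.crosses e (a, False, 0) then ?h (head a) - ?h (tail a) else 0)"
      using residual.descent_le_crossing[OF finite_units w] by (simp cong: if_cong)
    also have "\<dots> = - (\<Sum>e\<in>?N. ?\<chi> e a)"
      unfolding sum_negf[symmetric] by (intro sum.cong) (auto simp: frag_char_unit[OF w])
    finally show ?thesis using less by (intro mult_left_mono_neg) auto
  qed simp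
  have "2 * flow_value E tail head s g - 2 * flow_value E tail head s (\<lambda>a. real (\<phi> a))
      = (\<Sum>a\<in>E. (g a - real (\<phi> a)) * (?h (tail a) - ?h (head a)))"
    using sum_potential_flow[OF cg, of ?h] sum_potential_flow[OF \<phi>_conserved, of ?h]
    by (simp add: h left_diff_distrib sum_subtractf)
  also have "\<dots> \<le> (\<Sum>a\<in>E. (g a - real (\<phi> a)) * (\<Sum>e\<in>?N. ?\<chi> e a))"
    by (rule sum_mono[OF point])
  also have "\<dots> = (\<Sum>e\<in>?N. (\<Sum>a\<in>E. g a * ?\<chi> e a) - (\<Sum>a\<in>E. real (\<phi> a) * ?\<chi> e a))"
    unfolding sum_distrib_left by (subst sum.swap) (simp add: left_diff_distrib sum_subtractf)
  also have "\<dots> \<le> 0"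
  proof (rule sum_nonpos)
    fix e assume "e \<in> ?N"
    then have e: "residual.entry e" by simp
    show "(\<Sum>a\<in>E. g a * ?\<chi> e a) - (\<Sum>a\<in>E. real (\<phi> a) * ?\<chi> e a) \<le> 0"
      unfolding frag_tight(2)[OF e nr] using g frag_tight(1)[OF e nr] by (simp add: lp_feasible_def)
  qed
  finally show ?thesis by simp
qed

section \<open>Augmentation along a regular trail and its mirror image\<close>

text \<open>Regularity makes \<open>p\<close> and its mirror image disjoint. Their union is closed
  under mates, so changing the flow by one on each of its units preserves symmetry and the
  bounds.\<close>

lemma augment:
  assumes "residual.reach (sv s)"
  shows "\<exists>g. is_IS_flow V E tail head sv se u s g \<and>
    flow_value E tail head s (\<lambda>a. real (\<phi> a)) < flow_value E tail head s g"
proof -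
  obtain p where reg: "residual.regular p" and walk: "residual.walk s p (sv s)"
    using assms by (auto simp: residual.reach_def residual.rtrail_def)
  let ?q = "residual.mirror p"
  have pW: "set p \<subseteq> units" using reg by (simp add: residual.regular_def)
  have regq: "residual.regular ?q" by (rule residual.regular_mirror[OF reg])
  have walkq: "residual.walk s ?q (sv s)"
    using residual.walk_mirror[OF pW walk] sv(3)[OF s_in] by simp
  define T where "T = set p \<union> set ?q"
  have disj: "set p \<inter> set ?q = {}"
    using reg by (auto simp: residual.set_mirror residual.regular_def)
  have TW: "T \<subseteq> units" using pW regq by (auto simp: T_def residual.regular_def)
  have mT: "unit_mate w \<in> T" if "w \<in> T" for w
    using that pW residual.m_m by (auto simp: T_def residual.set_mirror)
  have mT_iff: "(se a, b, i) \<in> T \<longleftrightarrow> (a, b, i) \<in> T" if "a \<in> E" for a b i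
    using mT[of "(a, b, i)"] mT[of "(se a, b, i)"] se(3)[OF that] by auto
  define cnt where "cnt b a = card {i. (a, b, i) \<in> T}" for b a
  \<comment> \<open>Distinct units of one arc have distinct indices, so at most the residual
    capacity is used in each direction.\<close>
  have fibre: "{i. (a, b, i) \<in> T} \<subseteq> {..<if b then u a - \<phi> a else \<phi> a}" for a b
    using TW by (auto simp: units_def)
  have fib_fin: "finite {i. (a, b, i) \<in> T}" for a b
    using fibre by (rule finite_subset) simp
  have cnt_le: "cnt b a \<le> (if b then u a - \<phi> a else \<phi> a)" for a b
    unfolding cnt_def using card_mono[OF _ fibre] by simp
  define g where "g a = real (\<phi> a) + real (cnt True a) - real (cnt False a)" for a
  have value_g: "flow_value E tail head v g = flow_value E tail head v (\<lambda>a. real (\<phi> a))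
      + 2 * (of_bool (s = v) - of_bool (sv s = v))" for v
  proof -
    let ?k = "\<lambda>x. of_bool (x = v) :: real"
    let ?K = "\<lambda>w. ?k (unit_src w) - ?k (unit_dst w)"
    \<comment> \<open>Units are grouped by arc, then direction, then index, to turn the telescoping
      sum over the two trails into a sum over arcs.\<close>
    have T: "T = (SIGMA a:E. SIGMA b:UNIV. {i. (a, b, i) \<in> T})"
      using TW by (auto simp: units_def)
    have "sum ?K T = (\<Sum>(a, c)\<in>(SIGMA a:E. SIGMA b:UNIV. {i. (a, b, i) \<in> T}). ?K (a, c))"
      using T by (auto intro!: sum.cong)
    also have "\<dots> = (\<Sum>a\<in>E. \<Sum>c\<in>(SIGMA b:UNIV. {i. (a, b, i) \<in> T}). ?K (a, c))"
      using fin(2) fib_fin by (intro sum.Sigma[symmetric]) auto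
    also have "\<dots> = (\<Sum>a\<in>E. (real (cnt True a) - real (cnt False a)) * (?k (tail a) - ?k (head a)))"
    proof (rule sum.cong[OF refl])
      fix a
      have "(\<Sum>c\<in>(SIGMA b:UNIV. {i. (a, b, i) \<in> T}). ?K (a, c))
          = (\<Sum>(b, i)\<in>(SIGMA b:UNIV. {i. (a, b, i) \<in> T}). ?K (a, b, i))"
        by (intro sum.cong) auto
      also have "\<dots> = (\<Sum>b\<in>UNIV. \<Sum>i\<in>{i. (a, b, i) \<in> T}. ?K (a, b, i))"
        using fib_fin by (intro sum.Sigma[symmetric]) auto
      also have "\<dots> = (real (cnt True a) - real (cnt False a)) * (?k (tail a) - ?k (head a))"
        by (simp add: UNIV_bool cnt_def algebra_simps)
      finally show "(\<Sum>c\<in>(SIGMA b:UNIV. {i. (a, b, i) \<in> T}). ?K (a, c))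
          = (real (cnt True a) - real (cnt False a)) * (?k (tail a) - ?k (head a))" .
    qed
    finally have "(\<Sum>a\<in>E. (real (cnt True a) - real (cnt False a)) * (?k (tail a) - ?k (head a)))
        = sum ?K (set p) + sum ?K (set ?q)"
      unfolding T_def using disj by (simp add: sum.union_disjoint)
    moreover have "sum ?K (set r) = ?k s - ?k (sv s)"
      if "residual.regular r" "residual.walk s r (sv s)" for r
      using residual.walk_telescope[OF that(2), of ?k] that(1)
      by (simp add: residual.regular_def sum_list_distinct_conv_sum_set)
    ultimately have "(\<Sum>a\<in>E. (real (cnt True a) - real (cnt False a)) * (?k (tail a) - ?k (head a)))
        = 2 * (?k s - ?k (sv s))"
      using reg walk regq walkq by simp
    moreover have "flow_value E tail head v g = flow_value E tail head v (\<lambda>a. real (\<phi> a))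
        + (\<Sum>a\<in>E. (real (cnt True a) - real (cnt False a)) * (?k (tail a) - ?k (head a)))"
      unfolding flow_value_eq sum.distrib[symmetric]
      by (intro sum.cong) (auto simp: g_def algebra_simps)
    ultimately show ?thesis by simp
  qed
  have "is_IS_flow V E tail head sv se u s g"
    unfolding is_IS_flow_def is_flow_def flow_value_def[symmetric]
  proof (intro conjI ballI)
    fix a assume a: "a \<in> E"
    show "0 \<le> g a" using cnt_le[of False a] by (simp add: g_def)
    show "g a \<le> real (u a)" using cnt_le[of True a] \<phi>_le[OF a] by (simp add: g_def)
    show "g a \<in> \<int>" by (simp add: g_def)
    show "g (se a) = g a" using a by (simp add: g_def cnt_def \<phi>_se mT_iff)
  next
    fix v assume "v \<in> V - {s, sv s}"
    then show "flow_value E tail head v g = 0" using value_g[of v] \<phi>_conserved by auto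
  qed
  moreover have "flow_value E tail head s (\<lambda>a. real (\<phi> a)) < flow_value E tail head s g"
    using value_g[of s] sv(2)[OF s_in] by simp
  ultimately show ?thesis by blast
qed

end

section \<open>From maximum IS-flows to optimal LP solutions\<close>

theorem mainTheorem7:
  fixes V :: "'v set" and E :: "'e set" and tail head :: "'e \<Rightarrow> 'v"
    and sv :: "'v \<Rightarrow> 'v" and se :: "'e \<Rightarrow> 'e" and u :: "'e \<Rightarrow> nat" and s :: 'v
    and f :: "'e \<Rightarrow> real"
  assumes "skew_sym_network V E tail head sv se u s"
    and "\<forall>a\<in>E. head a \<noteq> s"
    and "is_max_IS_flow V E tail head sv se u s f"
  shows "lp_optimal V E tail head sv se u s f"
proof -
  interpret skew_network V E tail head sv se u s using assms(1) by unfold_locales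
  have f: "is_IS_flow V E tail head sv se u s f"
    and mx: "\<And>g. is_IS_flow V E tail head sv se u s g \<Longrightarrow>
      flow_value E tail head s g \<le> flow_value E tail head s f"
    using assms(3) by (auto simp: is_max_IS_flow_def)
  \<comment> \<open>On \<open>E\<close> the flow is integral and nonnegative, so the floor is
    exact.\<close>
  define \<phi> where "\<phi> a = nat \<lfloor>f a\<rfloor>" for a
  have \<phi>: "real (\<phi> a) = f a" if "a \<in> E" for a
    using f that unfolding is_IS_flow_def is_flow_def \<phi>_def
    by (metis Ints_cases floor_of_int of_int_0_le_iff of_int_of_nat_eq int_nat_eq)
  have value_\<phi>: "flow_value E tail head v (\<lambda>a. real (\<phi> a)) = flow_value E tail head v f" for v
    unfolding flow_value_eq by (intro sum.cong) (auto simp: \<phi>)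
  have fb: "f a \<le> real (u a)" "f (se a) = f a" if "a \<in> E" for a
    using f that by (auto simp: is_IS_flow_def is_flow_def)
  have fc: "\<forall>v\<in>V - {s, sv s}. flow_value E tail head v f = 0"
    using f by (auto simp: is_IS_flow_def is_flow_def flow_value_def)
  interpret skew_flow V E tail head sv se u s \<phi>
  proof
    fix a assume a: "a \<in> E"
    show "\<phi> a \<le> u a" using fb(1)[OF a] \<phi>[OF a] by simp
    show "\<phi> (se a) = \<phi> a" using fb(2)[OF a] by (simp add: \<phi>_def)
  next
    show "\<forall>v\<in>V - {s, sv s}. flow_value E tail head v (\<lambda>a. real (\<phi> a)) = 0"
      using fc by (simp add: value_\<phi>)
  qed
  \<comment> \<open>Otherwise augmentation would produce an IS-flow of larger value.\<close>
  have nr: "\<not> residual.reach (sv s)" using augment mx by (auto simp: value_\<phi> not_le[symmetric])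
  have "lp_feasible V E tail head sv se u s f"
  proof -
    have "(\<Sum>a\<in>E. f a * frag_char E tail head se C U a) \<le> 2 * real (\<Sum>a\<in>U. u a) - 2"
      if "odd_fragment V E tail head sv u s C U" for C U
      using fragment_inequality[OF that] by (simp add: \<phi>)
    then show ?thesis using f by (simp add: lp_feasible_def is_IS_flow_def is_flow_def)
  qed
  moreover have "lp_objective E tail s g = flow_value E tail head s g" for g
  proof -
    have "arcs_in E head s = {}" using assms(2) by (auto simp: arcs_in_def)
    then show ?thesis by (simp add: lp_objective_def flow_value_def)
  qed
  ultimately show ?thesis
    using lp_bound[OF nr] by (simp add: lp_optimal_def value_\<phi>)
qed

end
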